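(* Let $\sigma_\delta>0$, $\sigma_g^2=\ln(1+\sigma_\delta^2)$, and let $(\lambda_1,\lambda_2,\lambda_3)$ be distributed according to the Log-Doroshkevich probability density on $\{\lambda_1\ge\lambda_2\ge\lambda_3>-1\}$. Let $F_{\rm C}^{\rm LN},F_{\rm F}^{\rm LN},F_{\rm W}^{\rm LN},F_{\rm V}^{\rm LN}$ be the probabilities that exactly $3$, $2$, $1$, $0$ of the $\lambda_i$, respectively, are positive. Then $$F_{\rm C}^{\rm LN}=F_{\rm V}^{\rm LN}\qquad\text{and}\qquad F_{\rm F}^{\rm LN}=F_{\rm W}^{\rm LN}$$ exactly.
   Context: The Log-Doroshkevich density with parameter $\sigma_g$ is $$\mathcal{N}_{\rm LN}\,\frac{\prod_{i<j}\ln\frac{1+\lambda_i}{1+\lambda_j}}{\prod_{i}(1+\lambda_i)}\exp\left[-\frac{3}{2\sigma_g^2}\left(2J_1^2-5J_2\right)\right],\qquad \lambda_1\ge\lambda_2\ge\lambda_3>-1,$$ where $J_1=\sum_i\ln(1+\lambda_i)$, $J_2=\sum_{i<j}\ln(1+\lambda_i)\ln(1+\lambda_j)$, and $\mathcal{N}_{\rm LN}=\frac{15^3}{8\pi\sqrt5\,\sigma_g^6}$ is the constant making it a probability density. The classes are: cluster (C) three positive values, filament (F) two, wall (W) one, void (V) none. *)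

theory Defs
  imports "HOL-Probability.Probability"
begin

text \<open>
  Eigenvalue triples are vectors in \<open>real ^ 3\<close>. In the index type the numeral \<open>3\<close> equals \<open>0\<close>, so
  its built-in order is not the order of the eigenvalues; all expressions over
  pairs \<open>i < j\<close> are therefore written out as (1,2), (1,3), (2,3).
\<close>

definition ordered_region :: "(real ^ 3) set" where
  "ordered_region = {l. l $ 1 \<ge> l $ 2 \<and> l $ 2 \<ge> l $ 3 \<and> l $ 3 > -1}"

definition J1 :: "real ^ 3 \<Rightarrow> real" where
  "J1 l = (\<Sum>i\<in>UNIV. ln (1 + l $ i))"

definition J2 :: "real ^ 3 \<Rightarrow> real" where
  "J2 l = ln (1 + l $ 1) * ln (1 + l $ 2) + ln (1 + l $ 1) * ln (1 + l $ 3)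
        + ln (1 + l $ 2) * ln (1 + l $ 3)"

definition log_doroshkevich_const :: "real \<Rightarrow> real" where
  "log_doroshkevich_const \<sigma>\<^sub>g = 15 ^ 3 / (8 * pi * sqrt 5 * \<sigma>\<^sub>g ^ 6)"

definition log_doroshkevich_density :: "real \<Rightarrow> real ^ 3 \<Rightarrow> real" where
  "log_doroshkevich_density \<sigma>\<^sub>g l =
     (if l \<in> ordered_region then
        log_doroshkevich_const \<sigma>\<^sub>g
        * ((ln ((1 + l $ 1) / (1 + l $ 2)) * ln ((1 + l $ 1) / (1 + l $ 3))
              * ln ((1 + l $ 2) / (1 + l $ 3)))
           / (\<Prod>i\<in>UNIV. 1 + l $ i))
        * exp (- (3 / (2 * \<sigma>\<^sub>g\<^sup>2)) * (2 * (J1 l)\<^sup>2 - 5 * J2 l))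
      else 0)"

definition num_positive :: "real ^ 3 \<Rightarrow> nat" where
  "num_positive l = card {i. l $ i > 0}"

definition cluster_prob :: "'a measure \<Rightarrow> ('a \<Rightarrow> real ^ 3) \<Rightarrow> real" where
  "cluster_prob M L = measure M {\<omega> \<in> space M. num_positive (L \<omega>) = 3}"

definition filament_prob :: "'a measure \<Rightarrow> ('a \<Rightarrow> real ^ 3) \<Rightarrow> real" where
  "filament_prob M L = measure M {\<omega> \<in> space M. num_positive (L \<omega>) = 2}"

definition wall_prob :: "'a measure \<Rightarrow> ('a \<Rightarrow> real ^ 3) \<Rightarrow> real" where
  "wall_prob M L = measure M {\<omega> \<in> space M. num_positive (L \<omega>) = 1}"

definition void_prob :: "'a measure \<Rightarrow> ('a \<Rightarrow> real ^ 3) \<Rightarrow> real" where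
  "void_prob M L = measure M {\<omega> \<in> space M. num_positive (L \<omega>) = 0}"

end

(* The involution (l1, l2, l3) |-> (1/(1 + l3) - 1, 1/(1 + l2) - 1, 1/(1 + l1) - 1) of the ordered
   region acts on the logarithms ln (1 + l_i) as reversal combined with negation. It therefore
   negates J1, fixes J2 and the product of log-differences, and its Jacobian, the inverse square
   of the product of the 1 + l_i, accounts for the change of the denominator, so it preserves the
   law. It exchanges positive and negative eigenvalues, and the eigenvalue 0 has probability 0. *)
theory Submission
  imports Defs
begin

definition reciprocal_reversal :: "real ^ 3 \<Rightarrow> real ^ 3" where
  "reciprocal_reversal l =
     vector [1 / (1 + l $ 3) - 1, 1 / (1 + l $ 2) - 1, 1 / (1 + l $ 1) - 1]"

text \<open>As a linear map in \<open>h\<close> this has an antidiagonal matrix, so its determinant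
  is a signed product of three entries.\<close>

definition reciprocal_reversal_deriv :: "real ^ 3 \<Rightarrow> real ^ 3 \<Rightarrow> real ^ 3" where
  "reciprocal_reversal_deriv l h =
     vector [- h $ 3 / (1 + l $ 3)\<^sup>2, - h $ 2 / (1 + l $ 2)\<^sup>2, - h $ 1 / (1 + l $ 1)\<^sup>2]"

lemma reciprocal_reversal_nth [simp]:
  "reciprocal_reversal l $ 1 = 1 / (1 + l $ 3) - 1"
  "reciprocal_reversal l $ 2 = 1 / (1 + l $ 2) - 1"
  "reciprocal_reversal l $ 3 = 1 / (1 + l $ 1) - 1"
  by (simp_all add: reciprocal_reversal_def)

lemma reciprocal_reversal_involution [simp]:
  "reciprocal_reversal (reciprocal_reversal l) = l"
  by (simp add: vec_eq_iff forall_3)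

lemma reciprocal_reversal_in_ordered_region:
  assumes "l \<in> ordered_region"
  shows "reciprocal_reversal l \<in> ordered_region"
  using assms by (auto simp: ordered_region_def intro!: divide_left_mono mult_pos_pos)

lemma has_derivative_reciprocal_reversal:
  assumes "l \<in> ordered_region"
  shows "(reciprocal_reversal has_derivative reciprocal_reversal_deriv l) (at l within S)"
proof -
  have nz: "1 + l $ i \<noteq> 0" for i
    using assms exhaust_3[of i] by (auto simp: ordered_region_def)
  have inv: "((\<lambda>x. 1 / (1 + x $ i) - 1) has_derivative (\<lambda>h. - h $ i / (1 + l $ i)\<^sup>2)) (at l within S)"
    for i :: 3
    by (auto intro!: derivative_eq_intros bounded_linear_imp_has_derivative bounded_linear_vec_nth nz
        simp: power2_eq_square field_simps)
  have "((\<lambda>x. reciprocal_reversal x $ i) has_derivative (\<lambda>h. reciprocal_reversal_deriv l h $ i))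
      (at l within S)" for i
    using inv exhaust_3[of i] by (auto simp: reciprocal_reversal_deriv_def)
  then show ?thesis
    by (subst has_derivative_componentwise_within) (auto simp: Basis_vec_def inner_axis)
qed

lemma prod_UNIV_3: "prod f (UNIV :: 3 set) = f 1 * f 2 * f 3"
  unfolding UNIV_3 by (simp add: ac_simps)

text \<open>The odd reversal permutation contributes one minus sign and the three entries contribute
  three more, so the determinant is nonnegative. If some \<open>1 + l $ i\<close> vanishes, both
  sides are 0 by the convention \<open>inverse 0 = 0\<close>.\<close>

lemma det_reciprocal_reversal_deriv:
  "\<bar>det (matrix (reciprocal_reversal_deriv l))\<bar> = 1 / (\<Prod>i\<in>UNIV. 1 + l $ i)\<^sup>2"
proof -
  have "det (matrix (reciprocal_reversal_deriv l)) =
      inverse ((1 + l $ 1)\<^sup>2) * inverse ((1 + l $ 2)\<^sup>2) * inverse ((1 + l $ 3)\<^sup>2)"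
    by (simp add: det_3 matrix_def reciprocal_reversal_deriv_def axis_def divide_inverse)
  also have "\<dots> = 1 / (\<Prod>i\<in>UNIV. 1 + l $ i)\<^sup>2"
    unfolding prod_UNIV_3 power_mult_distrib inverse_mult_distrib[symmetric] divide_inverse by simp
  finally show ?thesis by simp
qed

lemma log_doroshkevich_density_reciprocal_reversal:
  assumes "l \<in> ordered_region"
  shows "\<bar>det (matrix (reciprocal_reversal_deriv l))\<bar>
           * log_doroshkevich_density s (reciprocal_reversal l) = log_doroshkevich_density s l"
proof -
  define a b c where "a = 1 + l $ 1" "b = 1 + l $ 2" "c = 1 + l $ 3"
  have pos: "a > 0" "b > 0" "c > 0"
    using assms by (auto simp: ordered_region_def a_b_c_def)
  have J1: "J1 (reciprocal_reversal l) = - J1 l"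
    using pos by (simp add: J1_def sum_3 ln_div a_b_c_def)
  have J2: "J2 (reciprocal_reversal l) = J2 l"
    using pos by (simp add: J2_def ln_div a_b_c_def)
  have "\<bar>det (matrix (reciprocal_reversal_deriv l))\<bar> = 1 / (a * b * c)\<^sup>2"
    by (simp add: det_reciprocal_reversal_deriv prod_UNIV_3 a_b_c_def mult_ac)
  \<comment> \<open>The shifted eigenvalues become \<open>1 / c\<close>, \<open>1 / b\<close>,
    \<open>1 / a\<close>: the first and third logarithms trade places, the middle one stays, and
    dividing by their product now means multiplying by \<open>a * b * c\<close>.\<close>
  moreover have "log_doroshkevich_density s (reciprocal_reversal l) =
      log_doroshkevich_const s * (ln (a / b) * ln (a / c) * ln (b / c) * (a * b * c))
      * exp (- (3 / (2 * s\<^sup>2)) * (2 * (J1 l)\<^sup>2 - 5 * J2 l))"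
    using pos assms reciprocal_reversal_in_ordered_region[OF assms]
    by (simp add: log_doroshkevich_density_def J1 J2 prod_UNIV_3 a_b_c_def[symmetric] mult_ac)
  moreover have "log_doroshkevich_density s l =
      log_doroshkevich_const s * (ln (a / b) * ln (a / c) * ln (b / c) / (a * b * c))
      * exp (- (3 / (2 * s\<^sup>2)) * (2 * (J1 l)\<^sup>2 - 5 * J2 l))"
    using assms by (simp add: log_doroshkevich_density_def prod_UNIV_3 a_b_c_def mult_ac)
  ultimately show ?thesis
    using pos by (simp add: power2_eq_square)
qed

text \<open>\<open>ennreal\<close> sends negative reals to 0, so nonnegativity is what lets the law
  of \<open>L\<close> be computed by real integrals of this function.\<close>

lemma log_doroshkevich_density_nonneg: "log_doroshkevich_density s l \<ge> 0"
proof (cases "l \<in> ordered_region")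
  case True
  then have "1 + l $ i > 0" for i
    using exhaust_3[of i] by (auto simp: ordered_region_def)
  with True show ?thesis
    unfolding log_doroshkevich_density_def log_doroshkevich_const_def
    by (simp only: if_True) (intro mult_nonneg_nonneg divide_nonneg_nonneg prod_nonneg ln_ge_zero,
        auto simp: ordered_region_def less_imp_le)
qed (simp add: log_doroshkevich_density_def)

text \<open>Bridge from a measure given by a density to the gauge integral
  \<open>integral A f\<close>, in which the change of variables is stated. Finiteness of the measure
  is exactly integrability of \<open>f\<close>.\<close>

lemma measure_density_lborel_eq_integral:
  fixes f :: "'a::euclidean_space \<Rightarrow> real"
  assumes "f \<in> borel_measurable lborel" "\<And>x. f x \<ge> 0"
    and "finite_measure (density lborel (\<lambda>x. ennreal (f x)))"
    and "A \<in> sets borel"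
  shows "f absolutely_integrable_on A"
    and "measure (density lborel (\<lambda>x. ennreal (f x))) A = integral A f"
proof -
  interpret D: finite_measure "density lborel (\<lambda>x. ennreal (f x))" by fact
  have [measurable]: "f \<in> borel_measurable borel" "A \<in> sets borel"
    using assms by auto
  have "(\<integral>\<^sup>+x. ennreal (f x) \<partial>lborel) < \<infinity>"
    using D.emeasure_finite[of UNIV] by (simp add: emeasure_density top.not_eq_extremum)
  then have "integrable lborel f"
    by (intro integrableI_nonneg) (auto simp: assms)
  then have int: "set_integrable lborel A f"
    unfolding set_integrable_def by (rule integrable_mult_indicator[rotated]) simp
  then show "f absolutely_integrable_on A"
    by (simp add: set_integrable_def integrable_completion)
  have "emeasure (density lborel (\<lambda>x. ennreal (f x))) A = (\<integral>\<^sup>+x. ennreal (indicator A x *\<^sub>R f x) \<partial>lborel)"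
    by (subst emeasure_density) (auto intro!: nn_integral_cong simp: indicator_def)
  also have "\<dots> = ennreal (LINT x:A|lborel. f x)"
    using int unfolding set_integrable_def set_lebesgue_integral_def
    by (rule nn_integral_eq_integral) (simp add: assms)
  also have "(LINT x:A|lborel. f x) = integral A f"
    using int by (rule set_borel_integral_eq_integral)
  finally show "measure (density lborel (\<lambda>x. ennreal (f x))) A = integral A f"
    by (simp add: measure_def integral_nonneg assms int set_borel_integral_eq_integral(1))
qed

text \<open>The vector-valued change of variables is applied in dimension one: \<open>vec\<close>
  embeds the reals into \<open>real ^ 1\<close>, and integrability is supplied on the image
  side.\<close>

lemma integral_change_of_variables_real:
  fixes f :: "real ^ 'm::{finite,wellorder} \<Rightarrow> real" and g :: "real ^ 'm::_ \<Rightarrow> real ^ 'm::_"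
  assumes "S \<in> sets lebesgue"
    and "\<And>x. x \<in> S \<Longrightarrow> (g has_derivative g' x) (at x within S)"
    and "inj_on g S"
    and "f absolutely_integrable_on g ` S"
  shows "integral (g ` S) f = integral S (\<lambda>x. \<bar>det (matrix (g' x))\<bar> * f (g x))"
proof -
  have "(\<lambda>x. vec (f x) :: real ^ 1) absolutely_integrable_on g ` S"
    using assms(4) by (simp add: absolutely_integrable_on_1_iff)
  then have "integral (g ` S) (\<lambda>x. vec (f x) :: real ^ 1) =
      integral S (\<lambda>x. \<bar>det (matrix (g' x))\<bar> *\<^sub>R vec (f (g x)))"
    by (intro integral_change_of_variables assms disjI1)
  then show ?thesis
    by (simp add: integral_on_1_eq)
qed

text \<open>A sum of indicators makes the count accessible to \<open>measurable\<close> and to case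
  distinctions on signs.\<close>

lemma num_positive_eq_sum:
  "num_positive l = (if l $ 1 > 0 then 1 else 0) + (if l $ 2 > 0 then 1 else 0)
     + (if l $ 3 > 0 then 1 else 0)"
proof -
  have "num_positive l = (\<Sum>i\<in>UNIV. if l $ i > 0 then 1 else 0)"
    by (simp add: num_positive_def sum.If_cases)
  then show ?thesis by (simp add: sum_3)
qed

lemma borel_measurable_vec_nth [measurable]:
  "(\<lambda>x :: real ^ 'n. x $ i) \<in> borel_measurable borel"
  by (intro borel_measurable_continuous_onI continuous_intros)

text \<open>Zero coordinates are left out because 0 is a fixed point of the map sending
  \<open>x\<close> to \<open>1 / (1 + x) - 1\<close> and does not count as positive; with them, the
  counts \<open>k\<close> and \<open>3 - k\<close> would not be exchanged.\<close>

definition generic_class :: "nat \<Rightarrow> (real ^ 3) set" where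
  "generic_class k = {l \<in> ordered_region. (\<forall>i. l $ i \<noteq> 0) \<and> num_positive l = k}"

lemma generic_class_borel [measurable]: "generic_class k \<in> sets borel"
  unfolding generic_class_def ordered_region_def num_positive_eq_sum forall_3 by measurable

lemma reciprocal_reversal_image_generic_class:
  assumes "k \<le> 3"
  shows "reciprocal_reversal ` generic_class k = generic_class (3 - k)"
proof -
  \<comment> \<open>Stated for every \<open>k\<close>, so that it also applies to
    \<open>3 - k\<close>; for an involution the two inclusions together give equality.\<close>
  have maps: "reciprocal_reversal l \<in> generic_class (3 - k)" if "l \<in> generic_class k" for l k
  proof -
    have l: "l \<in> ordered_region" "\<And>i. l $ i \<noteq> 0" "num_positive l = k"
      using that by (auto simp: generic_class_def)
    have "1 + l $ i > 0" for i
      using l(1) exhaust_3[of i] by (auto simp: ordered_region_def)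
    then have "1 / (1 + l $ i) - 1 > 0 \<longleftrightarrow> \<not> l $ i > 0" "1 / (1 + l $ i) - 1 \<noteq> 0" for i
      using l(2)[of i] by (auto simp: field_simps)
    then show ?thesis
      using l reciprocal_reversal_in_ordered_region[OF l(1)]
      by (auto simp: generic_class_def forall_3 num_positive_eq_sum)
  qed
  show ?thesis
  proof
    show "reciprocal_reversal ` generic_class k \<subseteq> generic_class (3 - k)"
      using maps by blast
    show "generic_class (3 - k) \<subseteq> reciprocal_reversal ` generic_class k"
    proof
      fix l assume "l \<in> generic_class (3 - k)"
      \<comment> \<open>Here \<open>k \<le> 3\<close> enters: subtraction on \<open>nat\<close>
        truncates, and \<open>3 - (3 - k)\<close> must be \<open>k\<close>.\<close>
      then have "reciprocal_reversal l \<in> generic_class k"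
        using maps[of l "3 - k"] assms by simp
      then have "reciprocal_reversal (reciprocal_reversal l) \<in> reciprocal_reversal ` generic_class k"
        by (rule imageI)
      then show "l \<in> reciprocal_reversal ` generic_class k"
        by simp
    qed
  qed
qed

text \<open>Change of variables along the involution; the Jacobian turns the transformed density
  back into the density itself at every point of the class.\<close>

lemma integral_generic_class:
  assumes "k \<le> 3" "log_doroshkevich_density s absolutely_integrable_on generic_class (3 - k)"
  shows "integral (generic_class (3 - k)) (log_doroshkevich_density s) =
    integral (generic_class k) (log_doroshkevich_density s)"
proof -
  have "integral (reciprocal_reversal ` generic_class k) (log_doroshkevich_density s) =
      integral (generic_class k) (\<lambda>l. \<bar>det (matrix (reciprocal_reversal_deriv l))\<bar>
        * log_doroshkevich_density s (reciprocal_reversal l))"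
  proof (rule integral_change_of_variables_real)
    show "inj_on reciprocal_reversal (generic_class k)"
      by (metis inj_onI reciprocal_reversal_involution)
    show "generic_class k \<in> sets lebesgue"
      using generic_class_borel by (intro sets_completionI_sets) simp
    show "(reciprocal_reversal has_derivative reciprocal_reversal_deriv l)
        (at l within generic_class k)" if "l \<in> generic_class k" for l
      using that by (simp add: generic_class_def has_derivative_reciprocal_reversal)
    show "log_doroshkevich_density s absolutely_integrable_on reciprocal_reversal ` generic_class k"
      using assms by (simp add: reciprocal_reversal_image_generic_class)
  qed
  also have "\<dots> = integral (generic_class k) (log_doroshkevich_density s)"
    by (intro integral_cong log_doroshkevich_density_reciprocal_reversal)
       (simp add: generic_class_def)
  finally show ?thesis
    using assms by (simp add: reciprocal_reversal_image_generic_class)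
qed

lemma num_positive_prob_symmetric:
  assumes "prob_space M"
    and D: "distributed M lborel L (\<lambda>l. ennreal (log_doroshkevich_density s l))"
    and "k \<le> 3"
  shows "measure M {\<omega> \<in> space M. num_positive (L \<omega>) = 3 - k} =
    measure M {\<omega> \<in> space M. num_positive (L \<omega>) = k}"
proof -
  let ?f = "log_doroshkevich_density s"
  let ?D = "density lborel (\<lambda>l. ennreal (?f l))"
  interpret prob_space M by fact
  have L [measurable]: "L \<in> borel_measurable M"
    using distributed_measurable[OF D] by simp
  have f [measurable]: "?f \<in> borel_measurable borel"
    using distributed_real_measurable[OF log_doroshkevich_density_nonneg D] by simp
  have distr: "distr M lborel L = ?D"
    using D by (rule distributed_distr_eq_density)
  have "prob_space (distr M lborel L)"
    using L by (intro prob_space_distr) simp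
  then have fin: "finite_measure ?D"
    by (simp add: distr prob_space.finite_measure)
  have nonzero: "AE l in lborel. (l :: real ^ 3) $ i \<noteq> 0" for i
  proof -
    have "negligible {l :: real ^ 3. l $ i = 0}"
      by (rule negligible_standard_hyperplane_cart)
    \<comment> \<open>Negligible sets are null for the completed measure; the hyperplane is Borel,
      hence null for \<open>lborel\<close> as well.\<close>
    then have "{l :: real ^ 3. l $ i = 0} \<in> null_sets lborel"
      by (auto simp: negligible_iff_null_sets null_sets_completion_iff)
    then show ?thesis
      by (auto dest: AE_not_in)
  qed
  have "measure M {\<omega> \<in> space M. num_positive (L \<omega>) = j} = integral (generic_class j) ?f" for j
  proof -
    have meas: "{l. num_positive l = j} \<in> sets borel"
      unfolding num_positive_eq_sum by measurable
    have "measure M {\<omega> \<in> space M. num_positive (L \<omega>) = j} =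
        measure (distr M lborel L) {l. num_positive l = j}"
      using meas by (subst measure_distr) (auto intro!: arg_cong[where f = "measure M"])
    also have "\<dots> = measure ?D (generic_class j)"
      unfolding distr
    \<comment> \<open>The two sets differ only outside \<open>ordered_region\<close>, where the
      density is 0, and on the three coordinate hyperplanes, which are null.\<close>
    proof (rule measure_eq_AE)
      have support: "l \<in> ordered_region" if "0 < ennreal (?f l)" for l
        using that by (simp add: log_doroshkevich_density_def split: if_splits)
      have "AE l in lborel. 0 < ennreal (?f l) \<longrightarrow>
          (l \<in> {l. num_positive l = j} \<longleftrightarrow> l \<in> generic_class j)"
        using nonzero[of 1] nonzero[of 2] nonzero[of 3]
        by eventually_elim (use support in \<open>auto simp only: generic_class_def forall_3 mem_Collect_eq\<close>)
      then show "AE l in ?D. l \<in> {l. num_positive l = j} \<longleftrightarrow> l \<in> generic_class j"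
        by (subst AE_density) simp_all
    qed (use meas in auto)
    also have "\<dots> = integral (generic_class j) ?f"
      by (rule measure_density_lborel_eq_integral(2))
        (use fin log_doroshkevich_density_nonneg in auto)
    finally show ?thesis .
  qed
  moreover have "?f absolutely_integrable_on generic_class (3 - k)"
    by (rule measure_density_lborel_eq_integral(1))
       (use fin log_doroshkevich_density_nonneg in auto)
  ultimately show ?thesis
    using integral_generic_class[OF \<open>k \<le> 3\<close>] by simp
qed

theorem mainTheorem2:
  fixes M :: "'a measure" and L :: "'a \<Rightarrow> real ^ 3" and \<sigma>\<^sub>\<delta> \<sigma>\<^sub>g :: real
  assumes "\<sigma>\<^sub>\<delta> > 0"
    and "\<sigma>\<^sub>g\<^sup>2 = ln (1 + \<sigma>\<^sub>\<delta>\<^sup>2)"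
    and "prob_space M"
    and "distributed M lborel L (\<lambda>l. ennreal (log_doroshkevich_density \<sigma>\<^sub>g l))"
  shows "cluster_prob M L = void_prob M L \<and> filament_prob M L = wall_prob M L"
  \<comment> \<open>\<open>k = 0\<close> pairs clusters with voids, and \<open>k = 1\<close> pairs
    filaments with walls.\<close>
  using num_positive_prob_symmetric[OF assms(3,4), of 0]
    num_positive_prob_symmetric[OF assms(3,4), of 1]
  by (simp add: cluster_prob_def void_prob_def filament_prob_def wall_prob_def)

end
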